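(* Let $\mathcal{P}$ be a family of probability distributions on $\mathcal{X}$. If $\mathcal{P}$ admits $\mathfrak{F}$-equivalence (that is, for all $\mathbb{P},\mathbb{Q}\in\mathcal{P}$ with densities $f,g$ and random variables $X\sim\mathbb{P}$, $Y\sim\mathbb{Q}$, the real random variables $f(X)$ and $g(Y)$ have the same distribution), then $\mathcal{P}$ admits $\beta$-equivalence (that is, for all $\mathbb{P},\mathbb{Q}\in\mathcal{P}$, all $k\ge 0$ and all $0\le s<t$, $\beta_k(\mathbb{P};s,t)=\beta_k(\mathbb{Q};s,t)$).
   Context: Standing assumptions: $\mathcal{X}$ either is a subset of $\mathbb{R}^d$ containing an open subset of $\mathbb{R}^d$, or is a compact $d$-dimensional $\mathcal{C}^1$-manifold in $\mathbb{R}^D$ with $d<D$. Every probability distribution $\mathbb{P}$ considered on $\mathcal{X}$ has a density $f=d\mathbb{P}/d\mu$ with respect to a canonical base measure $\mu$ on $\mathcal{X}$ (e.g. $d$-dimensional Lebesgue measure when $\mathcal{X}$ contains an open subset of $\mathbb{R}^d$; integration against it is written $dx$), and $f\in L^p(\mathcal{X},\mu)$ for all $1\le p<\infty$. Thermodynamic limit: for each $k\ge 0$ there are fixed real-valued (measurable) functions $\gamma_k,\varsigma_k$ of two nonnegative real variables, depending only on $k$ (for the given dimension $d$) and not on the distribution, such that the $(s,t)$-persistent Betti numbers of order $k$ of the Čech complex on the rescaled i.i.d. sample $n^{1/d}\{X_1,\dots,X_n\}$ from $\mathbb{P}$ have asymptotic mean functional (limit of the persistent Betti number divided by $n$) and asymptotic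 variance functional (variance in the $\sqrt n$ central limit theorem) given respectively by $$\mu_k(\mathbb{P};s,t)=\int_{\mathcal{X}}\gamma_k\big(f(x)^{1/d}s,\,f(x)^{1/d}t\big)f(x)\,dx,\qquad \sigma_k^2(\mathbb{P};s,t)=\int_{\mathcal{X}}\varsigma_k\big(f(x)^{1/d}s,\,f(x)^{1/d}t\big)f(x)\,dx .$$ Define $\beta_k(\mathbb{P};s,t)=\big(\mu_k(\mathbb{P};s,t),\sigma_k^2(\mathbb{P};s,t)\big)$. Two distributions $\mathbb{P},\mathbb{Q}$ admit $\beta$-equivalence if $\beta_k(\mathbb{P};s,t)=\beta_k(\mathbb{Q};s,t)$ for all $k\ge0$ and all $0\le s<t$; a family admits $\beta$-equivalence if every two of its members do. Two distributions with densities $f,g$ are $\mathfrak{F}$-equivalent if $f(X)$ and $g(Y)$ are equal in distribution, where $X$ has density $f$ and $Y$ has density $g$; a family admits $\mathfrak{F}$-equivalence if every two of its members are $\mathfrak{F}$-equivalent. *)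

theory Defs
  imports "HOL-Probability.Probability" "HOL-Library.Function_Algebras"
begin

section \<open>The sample space and its base measure\<close>

definition C1_on :: "('a::real_normed_vector \<Rightarrow> 'b::real_normed_vector) \<Rightarrow> 'a set \<Rightarrow> bool" where
  "C1_on \<phi> U \<longleftrightarrow> (\<exists>\<phi>' :: 'a \<Rightarrow> 'a \<Rightarrow>\<^sub>L 'b. continuous_on U \<phi>' \<and>
     (\<forall>x\<in>U. (\<phi> has_derivative blinfun_apply (\<phi>' x)) (at x)))"

text \<open>Embedded submanifolds without boundary, by straightening charts of the ambient space.\<close>

definition C1_submanifold :: "nat \<Rightarrow> 'a::euclidean_space set \<Rightarrow> bool" where
  "C1_submanifold d X \<longleftrightarrow> (\<forall>x\<in>X. \<exists>(U :: 'a set) (V :: 'a set) \<phi> \<psi> S.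
     open U \<and> x \<in> U \<and> open V \<and> homeomorphism U V \<phi> \<psi> \<and> C1_on \<phi> U \<and> C1_on \<psi> V \<and>
     subspace S \<and> dim S = d \<and> \<phi> ` (U \<inter> X) = V \<inter> S)"

definition admissible_space :: "nat \<Rightarrow> 'a::euclidean_space set \<Rightarrow> bool" where
  "admissible_space d X \<longleftrightarrow>
     d = DIM('a) \<and> X \<in> sets lebesgue \<and> (\<exists>U. open U \<and> U \<noteq> {} \<and> U \<subseteq> X) \<or>
     0 < d \<and> d < DIM('a) \<and> compact X \<and> C1_submanifold d X"

text \<open>
  The normalised \<open>d\<close>-dimensional Hausdorff measure. On an embedded \<open>C\<^sup>1\<close> submanifold of dimension
  \<open>d\<close> it is the Riemannian volume (by the area formula). The set function
  \<open>hausdorff_outer d\<close> is a metric outer measure for \<open>d > 0\<close>, hence countably additive on the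
  Borel sets, so that \<open>measure_of\<close> below does not degenerate.
\<close>

definition hausdorff_outer :: "nat \<Rightarrow> 'a::metric_space set \<Rightarrow> ennreal" where
  "hausdorff_outer d A =
     (SUP \<delta>\<in>{0<..}. INF U\<in>{U :: nat \<Rightarrow> 'a set. A \<subseteq> (\<Union>i. U i) \<and> (\<forall>i. bounded (U i) \<and> diameter (U i) \<le> \<delta>)}.
        \<Sum>i. ennreal (unit_ball_vol (real d) * (diameter (U i) / 2) ^ d))"

definition hausdorff_measure :: "nat \<Rightarrow> 'a::metric_space measure" where
  "hausdorff_measure d = measure_of UNIV (sets borel) (hausdorff_outer d)"

definition base_measure :: "nat \<Rightarrow> 'a::euclidean_space set \<Rightarrow> 'a measure" where
  "base_measure d X =
     (if d = DIM('a) then lebesgue_on X else restrict_space (hausdorff_measure d) X)"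

section \<open>Distributions and densities\<close>

definition admissible_distribution :: "'a measure \<Rightarrow> 'a measure \<Rightarrow> bool" where
  "admissible_distribution \<mu> P \<longleftrightarrow> prob_space P \<and>
     (\<exists>f :: 'a \<Rightarrow> real. f \<in> borel_measurable \<mu> \<and> (\<forall>x. 0 \<le> f x) \<and>
        P = density \<mu> (\<lambda>x. ennreal (f x)) \<and>
        (\<forall>p\<ge>1. integrable \<mu> (\<lambda>x. f x powr p)))"

definition real_density :: "'a measure \<Rightarrow> 'a measure \<Rightarrow> 'a \<Rightarrow> real" where
  "real_density \<mu> P x = enn2real (RN_deriv \<mu> P x)"

definition F_equivalent :: "'a measure \<Rightarrow> 'a measure \<Rightarrow> 'a measure \<Rightarrow> bool" where
  "F_equivalent \<mu> P Q \<longleftrightarrow> distr P borel (real_density \<mu> P) = distr Q borel (real_density \<mu> Q)"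

definition admits_F_equivalence :: "'a measure \<Rightarrow> 'a measure set \<Rightarrow> bool" where
  "admits_F_equivalence \<mu> \<P> \<longleftrightarrow> (\<forall>P\<in>\<P>. \<forall>Q\<in>\<P>. F_equivalent \<mu> P Q)"

section \<open>Persistent Betti numbers of Cech complexes\<close>

text \<open>
  Vertices are the indices of the sample points; their natural order orients the simplices.
  Balls are closed balls of the ambient Euclidean space, and \<open>r\<close> is their radius.
\<close>

definition cech_complex :: "nat \<Rightarrow> (nat \<Rightarrow> 'a::metric_space) \<Rightarrow> real \<Rightarrow> nat set set" where
  "cech_complex n x r =
     {\<sigma>. \<sigma> \<subseteq> {..<n} \<and> \<sigma> \<noteq> {} \<and> (\<Inter>i\<in>\<sigma>. cball (x i) r) \<noteq> {}}"

definition chains :: "nat \<Rightarrow> nat set set \<Rightarrow> (nat set \<Rightarrow> 'f::field) set" where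
  "chains k K = {c. \<forall>\<sigma>. c \<sigma> \<noteq> 0 \<longrightarrow> \<sigma> \<in> K \<and> card \<sigma> = Suc k}"

text \<open>
  The coefficient of \<open>\<tau>\<close> in the boundary of \<open>c\<close> collects the simplices of \<open>c\<close> having \<open>\<tau>\<close> as a
  facet. The empty face is suppressed, so homology is not reduced.
\<close>

definition boundary :: "(nat set \<Rightarrow> 'f::field) \<Rightarrow> nat set \<Rightarrow> 'f" where
  "boundary c \<tau> = (if \<tau> = {} then 0 else
     \<Sum>v | v \<notin> \<tau> \<and> c (insert v \<tau>) \<noteq> 0. (- 1) ^ card {u\<in>\<tau>. u < v} * c (insert v \<tau>))"

definition cycles :: "nat \<Rightarrow> nat set set \<Rightarrow> (nat set \<Rightarrow> 'f::field) set" where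
  "cycles k K = {c \<in> chains k K. \<forall>\<tau>. boundary c \<tau> = 0}"

definition boundaries :: "nat \<Rightarrow> nat set set \<Rightarrow> (nat set \<Rightarrow> 'f::field) set" where
  "boundaries k K = boundary ` chains (Suc k) K"

definition chain_scale :: "'f::field \<Rightarrow> (nat set \<Rightarrow> 'f) \<Rightarrow> nat set \<Rightarrow> 'f" where
  "chain_scale a c = (\<lambda>\<sigma>. a * c \<sigma>)"

lemma vector_space_chain_scale: "vector_space chain_scale"
  by unfold_locales (auto simp: chain_scale_def fun_eq_iff algebra_simps)

text \<open>
  For finite complexes \<open>K \<subseteq> L\<close> this is the dimension of the quotient of \<open>cycles k K\<close> by
  \<open>cycles k K \<inter> boundaries k L\<close>, that is, the rank of \<open>H\<^sub>k(K) \<rightarrow> H\<^sub>k(L)\<close> over the field \<open>'f\<close>.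
\<close>

definition persistent_betti :: "'f::field itself \<Rightarrow> nat \<Rightarrow> nat set set \<Rightarrow> nat set set \<Rightarrow> nat" where
  "persistent_betti _ k K L =
     vector_space.dim chain_scale (cycles k K :: (nat set \<Rightarrow> 'f) set)
     - vector_space.dim chain_scale (cycles k K \<inter> boundaries k L :: (nat set \<Rightarrow> 'f) set)"

section \<open>Asymptotic mean and variance in the thermodynamic regime\<close>

definition iid_sample :: "'a measure \<Rightarrow> (nat \<Rightarrow> 'a) measure" where
  "iid_sample P = Pi\<^sub>M UNIV (\<lambda>_. P)"

definition sample_betti ::
  "'f::field itself \<Rightarrow> nat \<Rightarrow> nat \<Rightarrow> real \<Rightarrow> real \<Rightarrow> nat \<Rightarrow> (nat \<Rightarrow> 'a::real_normed_vector) \<Rightarrow> real" where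
  "sample_betti F d k s t n x =
     (let y = (\<lambda>i. (real n powr (1 / real d)) *\<^sub>R x i)
      in real (persistent_betti F k (cech_complex n y s) (cech_complex n y t)))"

definition has_asymptotic_mean ::
  "'f::field itself \<Rightarrow> nat \<Rightarrow> 'a::real_normed_vector measure \<Rightarrow> nat \<Rightarrow> real \<Rightarrow> real \<Rightarrow> real \<Rightarrow> bool" where
  "has_asymptotic_mean F d P k s t m \<longleftrightarrow>
     (AE x in iid_sample P. (\<lambda>n. sample_betti F d k s t n x / real n) \<longlonglongrightarrow> m)"

text \<open>
  The normal law with mean \<open>0\<close> and variance \<open>v\<close> is written as the law of \<open>sqrt v * Z\<close>, with \<open>Z\<close>
  standard normal, so that the degenerate case \<open>v = 0\<close> is included.
\<close>

definition has_asymptotic_variance ::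
  "'f::field itself \<Rightarrow> nat \<Rightarrow> 'a::real_normed_vector measure \<Rightarrow> nat \<Rightarrow> real \<Rightarrow> real \<Rightarrow> real \<Rightarrow> bool" where
  "has_asymptotic_variance F d P k s t v \<longleftrightarrow> 0 \<le> v \<and>
     weak_conv_m
       (\<lambda>n. distr (iid_sample P) borel (\<lambda>x.
          (sample_betti F d k s t n x - (\<integral>y. sample_betti F d k s t n y \<partial>iid_sample P)) / sqrt (real n)))
       (distr std_normal_distribution borel (\<lambda>z. sqrt v * z))"

definition asymptotic_mean ::
  "'f::field itself \<Rightarrow> nat \<Rightarrow> 'a::real_normed_vector measure \<Rightarrow> nat \<Rightarrow> real \<Rightarrow> real \<Rightarrow> real" where
  "asymptotic_mean F d P k s t = (THE m. has_asymptotic_mean F d P k s t m)"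

definition asymptotic_variance ::
  "'f::field itself \<Rightarrow> nat \<Rightarrow> 'a::real_normed_vector measure \<Rightarrow> nat \<Rightarrow> real \<Rightarrow> real \<Rightarrow> real" where
  "asymptotic_variance F d P k s t = (THE v. has_asymptotic_variance F d P k s t v)"

definition beta ::
  "'f::field itself \<Rightarrow> nat \<Rightarrow> 'a::real_normed_vector measure \<Rightarrow> nat \<Rightarrow> real \<Rightarrow> real \<Rightarrow> real \<times> real" where
  "beta F d P k s t = (asymptotic_mean F d P k s t, asymptotic_variance F d P k s t)"

definition beta_equivalent ::
  "'f::field itself \<Rightarrow> nat \<Rightarrow> 'a::real_normed_vector measure \<Rightarrow> 'a measure \<Rightarrow> bool" where
  "beta_equivalent F d P Q \<longleftrightarrow>
     (\<forall>k s t. 0 \<le> s \<and> s < t \<longrightarrow> beta F d P k s t = beta F d Q k s t)"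

definition admits_beta_equivalence ::
  "'f::field itself \<Rightarrow> nat \<Rightarrow> 'a::real_normed_vector measure set \<Rightarrow> bool" where
  "admits_beta_equivalence F d \<P> \<longleftrightarrow> (\<forall>P\<in>\<P>. \<forall>Q\<in>\<P>. beta_equivalent F d P Q)"

definition density_functional_integrand ::
  "nat \<Rightarrow> 'a measure \<Rightarrow> 'a measure \<Rightarrow> (real \<Rightarrow> real \<Rightarrow> real) \<Rightarrow> real \<Rightarrow> real \<Rightarrow> 'a \<Rightarrow> real" where
  "density_functional_integrand d \<mu> P g s t x =
     (let u = real_density \<mu> P x in g (u powr (1 / real d) * s) (u powr (1 / real d) * t) * u)"

text \<open>
  The strong law and the central limit theorem in the thermodynamic regime, for one distribution
  \<open>P\<close>. The functions \<open>\<gamma>\<close> and \<open>\<zeta>\<close> are parameters so that they can be shared by all distributions.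
\<close>

definition thermodynamic_limit ::
  "'f::field itself \<Rightarrow> nat \<Rightarrow> 'a::real_normed_vector measure \<Rightarrow> (nat \<Rightarrow> real \<Rightarrow> real \<Rightarrow> real) \<Rightarrow>
   (nat \<Rightarrow> real \<Rightarrow> real \<Rightarrow> real) \<Rightarrow> 'a measure \<Rightarrow> bool" where
  "thermodynamic_limit F d \<mu> \<gamma> \<zeta> P \<longleftrightarrow> (\<forall>k s t. 0 \<le> s \<and> s < t \<longrightarrow>
     integrable \<mu> (density_functional_integrand d \<mu> P (\<gamma> k) s t) \<and>
     integrable \<mu> (density_functional_integrand d \<mu> P (\<zeta> k) s t) \<and>
     has_asymptotic_mean F d P k s t (\<integral>x. density_functional_integrand d \<mu> P (\<gamma> k) s t x \<partial>\<mu>) \<and>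
     has_asymptotic_variance F d P k s t (\<integral>x. density_functional_integrand d \<mu> P (\<zeta> k) s t x \<partial>\<mu>))"

end

theory Submission
  imports Defs
begin

text \<open>
  Writing \<open>u\<close> for the density of \<open>P\<close>, the functional \<open>\<integral> \<gamma>(u\<^sup>1\<^sup>/\<^sup>d s, u\<^sup>1\<^sup>/\<^sup>d t) u d\<mu>\<close> is the expectation
  of a Borel function of \<open>u(X)\<close> with \<open>X\<close> of law \<open>P\<close>, so it depends only on the law of \<open>u(X)\<close>.
  The asymptotic mean and variance are the values of these functionals because almost sure limits
  are unique and the variance of a centred normal law is determined by its distribution function
  at \<open>1\<close>.
\<close>

text \<open>
  Proving that \<open>\<mu>\<close> is \<open>\<sigma>\<close>-finite is avoided, which would take work for the Hausdorff measure:
  \<open>\<sigma>\<close>-finiteness of \<open>P\<close> already gives almost everywhere uniqueness of its density.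
\<close>

lemma density_real_density:
  fixes f :: "'a \<Rightarrow> real"
  assumes "sigma_finite_measure P" and "f \<in> borel_measurable \<mu>"
    and "P = density \<mu> (\<lambda>x. ennreal (f x))"
  shows "density \<mu> (\<lambda>x. ennreal (real_density \<mu> P x)) = P"
proof -
  have "AE x in \<mu>. ennreal (f x) = RN_deriv \<mu> P x"
    using assms by (intro RN_deriv_unique_sigma_finite) simp_all
  then have "AE x in \<mu>. ennreal (real_density \<mu> P x) = ennreal (f x)"
  proof eventually_elim
    case (elim x)
    show ?case
      unfolding real_density_def elim[symmetric] by (rule ennreal_enn2real) simp
  qed
  then have "density \<mu> (\<lambda>x. ennreal (real_density \<mu> P x)) = density \<mu> (\<lambda>x. ennreal (f x))"
    using assms(2) by (intro density_cong) (auto simp: real_density_def)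
  with assms(3) show ?thesis by simp
qed

lemma borel_measurable_real_density [measurable]: "real_density \<mu> P \<in> borel_measurable \<mu>"
  unfolding real_density_def[abs_def] by measurable

lemma integral_density_functional_integrand:
  fixes f :: "'a \<Rightarrow> real"
  assumes "sigma_finite_measure P" and "f \<in> borel_measurable \<mu>"
    and "P = density \<mu> (\<lambda>x. ennreal (f x))"
    and g: "case_prod g \<in> borel_measurable (restrict_space borel ({0..} \<times> {0..}))"
    and "0 \<le> s" "0 \<le> t"
  shows "(\<integral>x. density_functional_integrand d \<mu> P g s t x \<partial>\<mu>) =
    (\<integral>u. g (u powr (1 / real d) * s) (u powr (1 / real d) * t) \<partial>distr P borel (real_density \<mu> P))"
proof -
  define G where "G u = g (u powr (1 / real d) * s) (u powr (1 / real d) * t)" for u :: real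
  let ?h = "\<lambda>u::real. (u powr (1 / real d) * s, u powr (1 / real d) * t)"
  \<comment> \<open>\<open>g\<close> is assumed measurable on the closed quadrant only. Since
    \<open>powr\<close> is nonnegative for every real base and \<open>s\<close>, \<open>t\<close>
    are nonnegative, \<open>?h\<close> maps the whole line into it, so \<open>G\<close> is Borel on
    all reals.\<close>
  have "?h \<in> measurable borel (restrict_space borel ({0..} \<times> {0..}))"
    using assms(5,6) by (intro measurable_restrict_space2) (auto simp: borel_prod[symmetric])
  from measurable_comp[OF this g] have [measurable]: "G \<in> borel_measurable borel"
    by (simp add: G_def[abs_def] comp_def)
  have dens: "density \<mu> (\<lambda>x. ennreal (real_density \<mu> P x)) = P"
    using assms(1-3) by (rule density_real_density)
  have [measurable]: "real_density \<mu> P \<in> borel_measurable P"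
    using assms(3) by (metis borel_measurable_real_density measurable_cong_sets sets_density)
  have "(\<integral>u. G u \<partial>distr P borel (real_density \<mu> P)) = (\<integral>x. G (real_density \<mu> P x) \<partial>P)"
    by (rule integral_distr) measurable
  also have "\<dots> = (\<integral>x. G (real_density \<mu> P x) \<partial>density \<mu> (\<lambda>x. ennreal (real_density \<mu> P x)))"
    by (simp add: dens)
  \<comment> \<open>The trailing factor \<open>u\<close> of the integrand is exactly the density
    that turns integration against \<open>\<mu>\<close> into an expectation under
    \<open>P\<close>.\<close>
  also have "\<dots> = (\<integral>x. real_density \<mu> P x *\<^sub>R G (real_density \<mu> P x) \<partial>\<mu>)"
    by (rule integral_density) (auto simp: real_density_def)
  also have "\<dots> = (\<integral>x. density_functional_integrand d \<mu> P g s t x \<partial>\<mu>)"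
    by (simp add: density_functional_integrand_def G_def Let_def mult.commute)
  finally show ?thesis by (simp add: G_def)
qed

lemma asymptotic_mean_eqI:
  assumes "prob_space P" and "has_asymptotic_mean F d P k s t m"
  shows "asymptotic_mean F d P k s t = m"
  unfolding asymptotic_mean_def
proof (rule the_equality)
  fix m' assume "has_asymptotic_mean F d P k s t m'"
  with assms(2) have "AE x in iid_sample P. m' = m"
    unfolding has_asymptotic_mean_def by eventually_elim (rule LIMSEQ_unique)
  \<comment> \<open>The equation \<open>m' = m\<close> does not involve \<open>x\<close>; holding
    almost surely under a probability measure, it simply holds.\<close>
  moreover have "prob_space (iid_sample P)"
    unfolding iid_sample_def using assms(1) by (intro prob_space_PiM)
  ultimately show "m' = m"
    by (simp add: prob_space.AE_const)
qed fact

text \<open>The normal density vanishes nowhere, so a null interval would also be Lebesgue null.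
  This supplies the strictness in the comparison of distribution functions below.\<close>

lemma measure_std_normal_distribution_Ioo_pos:
  assumes "a < b"
  shows "0 < measure std_normal_distribution {a<..<b}"
proof -
  interpret prob_space std_normal_distribution
    by (rule prob_space_normal_density) simp
  have "{a<..<b} \<notin> null_sets std_normal_distribution"
  proof
    assume "{a<..<b} \<in> null_sets std_normal_distribution"
    then have "AE x in lborel. x \<in> {a<..<b} \<longrightarrow> ennreal (std_normal_density x) = 0"
      by (simp add: null_sets_density_iff del: ennreal_eq_0_iff)
    then have "AE x in lborel. x \<notin> {a<..<b}"
      by eventually_elim (metis normal_density_pos ennreal_eq_0_iff not_le zero_less_one)
    then have "{a<..<b} \<in> null_sets lborel"
      by (subst AE_iff_null_sets) auto
    with assms show False by (auto simp: null_sets_def)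
  qed
  then show ?thesis
    by (auto simp: null_sets_def emeasure_eq_measure zero_less_measure_iff)
qed

lemma measure_std_normal_distribution_singleton: "measure std_normal_distribution {a} = 0"
proof -
  have "emeasure std_normal_distribution {a} = 0"
    by (simp add: emeasure_density nn_integral_null_set)
  then show ?thesis by (simp add: measure_def)
qed

lemma real_distribution_scaled_std_normal:
  "real_distribution (distr std_normal_distribution borel (\<lambda>z. c * z))"
  by (intro prob_space.real_distribution_distr prob_space_normal_density) auto

text \<open>Weak convergence controls distribution functions only at continuity points. The point 1
  is never an atom: for \<open>c = 0\<close> all mass sits at 0, otherwise the law is a rescaled
  normal law without atoms.\<close>

lemma isCont_cdf_scaled_std_normal:
  "isCont (cdf (distr std_normal_distribution borel (\<lambda>z. c * z))) 1"
proof -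
  interpret real_distribution "distr std_normal_distribution borel (\<lambda>z. c * z)"
    by (rule real_distribution_scaled_std_normal)
  have "(\<lambda>z. c * z) -` {1} = (if c = 0 then {} else {1 / c})"
    by (auto simp: field_simps)
  then show ?thesis
    by (simp add: isCont_cdf measure_distr measure_std_normal_distribution_singleton)
qed

text \<open>As 1 is positive, the event \<open>c * z \<le> 1\<close> shrinks when \<open>c\<close>
  grows, and an interval of positive mass just right of \<open>1 / c'\<close> is lost. The
  degenerate law \<open>c = 0\<close> is covered too.\<close>

lemma cdf_scaled_std_normal_strict_antimono:
  assumes "0 \<le> c" "c < c'"
  shows "cdf (distr std_normal_distribution borel (\<lambda>z. c' * z)) 1
    < cdf (distr std_normal_distribution borel (\<lambda>z. c * z)) 1"
proof -
  interpret prob_space std_normal_distribution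
    by (rule prob_space_normal_density) simp
  have cdf: "cdf (distr std_normal_distribution borel (\<lambda>z. a * z)) 1 = prob {z. a * z \<le> 1}"
    for a :: real
    by (simp add: cdf_def measure_distr vimage_def)
  \<comment> \<open>For \<open>c = 0\<close> every \<open>z\<close> satisfies
    \<open>c * z \<le> 1\<close>, so any endpoint beyond \<open>1 / c'\<close> serves;
    \<open>1 / c\<close> would then be 0.\<close>
  define b where "b = (if c = 0 then 1 / c' + 1 else 1 / c)"
  have b: "1 / c' < b"
    using assms by (auto simp: b_def frac_less2)
  have le: "c * z \<le> 1" if "c' * z \<le> 1" for z
  proof (cases "0 \<le> z")
    case True
    then have "c * z \<le> c' * z" using assms by (intro mult_right_mono) auto
    with that show ?thesis by simp
  next
    case False
    with assms have "c * z \<le> 0" by (simp add: mult_nonneg_nonpos)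
    then show ?thesis by simp
  qed
  have "prob {z. c' * z \<le> 1} < prob {z. c' * z \<le> 1} + prob {1 / c'<..<b}"
    using measure_std_normal_distribution_Ioo_pos[OF b] by simp
  also have "\<dots> = prob ({z. c' * z \<le> 1} \<union> {1 / c'<..<b})"
    using assms by (intro finite_measure_Union[symmetric]) (auto simp: field_simps)
  also have "\<dots> \<le> prob {z. c * z \<le> 1}"
    using assms le by (intro finite_measure_mono) (auto simp: b_def field_simps split: if_splits)
  finally show ?thesis by (simp add: cdf)
qed

lemma scaled_std_normal_weak_limit_unique:
  assumes "weak_conv_m M (distr std_normal_distribution borel (\<lambda>z. a * z))"
    and "weak_conv_m M (distr std_normal_distribution borel (\<lambda>z. b * z))"
    and "0 \<le> a" "0 \<le> b"
  shows "a = b"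
proof -
  have "cdf (distr std_normal_distribution borel (\<lambda>z. a * z)) 1
      = cdf (distr std_normal_distribution borel (\<lambda>z. b * z)) 1"
    using assms(1,2) isCont_cdf_scaled_std_normal
    unfolding weak_conv_m_def weak_conv_def by (blast intro: LIMSEQ_unique)
  with cdf_scaled_std_normal_strict_antimono assms(3,4) show ?thesis
    by (metis less_irrefl linorder_neqE_linordered_idom)
qed

lemma asymptotic_variance_eqI:
  assumes "has_asymptotic_variance F d P k s t v"
  shows "asymptotic_variance F d P k s t = v"
  unfolding asymptotic_variance_def
proof (rule the_equality)
  fix v' assume "has_asymptotic_variance F d P k s t v'"
  with assms have "sqrt v' = sqrt v"
    unfolding has_asymptotic_variance_def
    by (intro scaled_std_normal_weak_limit_unique) auto
  then show "v' = v" by simp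
qed fact

theorem lemma3p5:
  fixes d :: nat and X :: "'a::euclidean_space set" and \<P> :: "'a measure set"
    and \<gamma> \<zeta> :: "nat \<Rightarrow> real \<Rightarrow> real \<Rightarrow> real"
  assumes "admissible_space d X"
    and "\<And>k. case_prod (\<gamma> k) \<in> borel_measurable (restrict_space borel ({0..} \<times> {0..}))"
    and "\<And>k. case_prod (\<zeta> k) \<in> borel_measurable (restrict_space borel ({0..} \<times> {0..}))"
    and "\<And>P. P \<in> \<P> \<Longrightarrow> admissible_distribution (base_measure d X) P"
    and "\<And>P. P \<in> \<P> \<Longrightarrow> thermodynamic_limit TYPE('f::field) d (base_measure d X) \<gamma> \<zeta> P"
    and "admits_F_equivalence (base_measure d X) \<P>"
  shows "admits_beta_equivalence TYPE('f) d \<P>"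
proof -
  let ?\<mu> = "base_measure d X"
  \<comment> \<open>The distribution enters \<open>I\<close> only through the law \<open>M\<close>
    of its density value, the object that equivalence of densities identifies.\<close>
  define I where "I g s t M = (\<integral>u. g (u powr (1 / real d) * s) (u powr (1 / real d) * t) \<partial>M)"
    for g :: "real \<Rightarrow> real \<Rightarrow> real" and s t and M :: "real measure"
  have beta: "beta TYPE('f) d P k s t =
      (I (\<gamma> k) s t (distr P borel (real_density ?\<mu> P)),
       I (\<zeta> k) s t (distr P borel (real_density ?\<mu> P)))"
    if P: "P \<in> \<P>" and st: "0 \<le> s" "s < t" for P k s t
  proof -
    obtain f where prob: "prob_space P" and f: "f \<in> borel_measurable ?\<mu>"
        "P = density ?\<mu> (\<lambda>x. ennreal (f x))"
      using assms(4)[OF P] unfolding admissible_distribution_def by blast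
    from prob have fin: "sigma_finite_measure P"
      by (simp add: prob_space_def finite_measure_def)
    have t: "0 \<le> t" using st by simp
    have I: "(\<integral>x. density_functional_integrand d ?\<mu> P g s t x \<partial>?\<mu>) =
        I g s t (distr P borel (real_density ?\<mu> P))"
      if "case_prod g \<in> borel_measurable (restrict_space borel ({0..} \<times> {0..}))" for g
      unfolding I_def by (rule integral_density_functional_integrand[OF fin f that st(1) t])
    have "has_asymptotic_mean TYPE('f) d P k s t
        (\<integral>x. density_functional_integrand d ?\<mu> P (\<gamma> k) s t x \<partial>?\<mu>)"
      and "has_asymptotic_variance TYPE('f) d P k s t
        (\<integral>x. density_functional_integrand d ?\<mu> P (\<zeta> k) s t x \<partial>?\<mu>)"
      using assms(5)[OF P] st by (simp_all add: thermodynamic_limit_def)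
    then show ?thesis
      by (simp add: beta_def asymptotic_mean_eqI[OF prob] asymptotic_variance_eqI
          I[OF assms(2)] I[OF assms(3)])
  qed
  have "distr P borel (real_density ?\<mu> P) = distr Q borel (real_density ?\<mu> Q)"
    if "P \<in> \<P>" "Q \<in> \<P>" for P Q
    using assms(6) that unfolding admits_F_equivalence_def F_equivalent_def by blast
  with beta have "beta TYPE('f) d P k s t = beta TYPE('f) d Q k s t"
    if "P \<in> \<P>" "Q \<in> \<P>" "0 \<le> s" "s < t" for P Q k s t
    using that by metis
  then show ?thesis
    unfolding admits_beta_equivalence_def beta_equivalent_def by blast
qed

end
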